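(* Let $U:\mathbb{R}^3\to\mathbb{R}$ be the scalar potential, $E=-\nabla U$, $B:\mathbb{R}^3\to\mathbb{R}^3$ the magnetic field, $\varepsilon\in(0,1]$ and $h>0$. Let $(x^n,v^n)_{n\in\mathbb{N}}$ be the numerical solution, with $x^0=x_0$, $v^0=v_0$, produced by the energy-preserving splitting method, i.e. $(x^{n+1},v^{n+1})=\Phi_h(x^n,v^n)$, where the one-step map $\Phi_h$ is obtained by composition of the propagators $\Phi^{L}$ and $\Phi^{NL}$ defined in the context; for example the Lie–Trotter scheme S1-AVF, $\Phi_h=\Phi^{NL}_h\circ\Phi^{L}_h$, that is $$x^{n+1}=x^{n}+h\,e^{\frac{h}{\varepsilon}\widehat B(x^n)}v^{n}+\frac{h^2}{2}\int_{0}^1E\big(\rho x^{n}+(1-\rho)x^{n+1}\big)\,d\rho,$$ $$v^{n+1}=e^{\frac{h}{\varepsilon}\widehat B(x^n)}v^{n}+h\int_{0}^1E\big(\rho x^{n}+(1-\rho)x^{n+1}\big)\,d\rho .$$ Then the method exactly preserves the energy $H(x,v)=\frac12|v|^2+U(x)$ at the discrete level: $$H(x^n,v^n)=H(x^0,v^0)\quad\text{for all } n\in\mathbb{N}.$$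
   Context: The charged-particle dynamics is the system $\dot x=v$, $\dot v=v\times \frac{B(x)}{\varepsilon}+E(x)$, $x(0)=x_0$, $v(0)=v_0$ in $\mathbb{R}^3\times\mathbb{R}^3$, with $E=-\nabla U$; its energy is $H(x,v)=\frac12|v|^2+U(x)$ ($|\cdot|$ the Euclidean norm). For $B=(b_1,b_2,b_3)^\top$ put $$\widehat B(x)=\begin{pmatrix}0&b_3(x)&-b_2(x)\\ -b_3(x)&0&b_1(x)\\ b_2(x)&-b_1(x)&0\end{pmatrix},$$ so that $\widehat B(x)v=v\times B(x)$. The propagator $\Phi^L_t$ maps $(x(0),v(0))$ to $(x(0),\,e^{\frac t\varepsilon\widehat B(x(0))}v(0))$. The propagator $\Phi^{NL}_t$ maps $(x(0),v(0))$ to $(x(t),v(t))$ determined (implicitly) by $$x(t)=x(0)+t\,v(0)+\frac{t^2}{2}\int_0^1E(\rho x(0)+(1-\rho)x(t))\,d\rho,\qquad v(t)=v(0)+t\int_0^1E(\rho x(0)+(1-\rho)x(t))\,d\rho .$$ A splitting method by composition has as one-step map $\Phi_h$ a finite composition of maps $\Phi^L_{a_ih}$ and $\Phi^{NL}_{b_ih}$ with real coefficients $a_i,b_i$. The numerical solution is any sequence satisfying these (implicit) relations. *)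

theory Defs
  imports "HOL-Analysis.Analysis"
begin

type_synonym state = "(real^3) \<times> (real^3)"

definition energy :: "(real^3 \<Rightarrow> real) \<Rightarrow> state \<Rightarrow> real" where
  "energy U = (\<lambda>(x, v). (norm v)\<^sup>2 / 2 + U x)"

definition hat :: "real^3 \<Rightarrow> real^3^3" where
  "hat b = vector [vector [0, b$3, - b$2],
                   vector [- b$3, 0, b$1],
                   vector [b$2, - b$1, 0]]"

lemma hat_mult_vec: "hat b *v v = cross3 v b"
  by (simp add: hat_def cross3_def vec_eq_iff forall_3 vector_3 matrix_vector_mult_def sum_3)

(* The library has no exponential on square matrices: the multiplication of type
   real^3^3 is componentwise, so the generic exp is not available. *)
primrec matpow :: "real^'n^'n \<Rightarrow> nat \<Rightarrow> real^'n^'n" where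
  "matpow A 0 = mat 1"
| "matpow A (Suc k) = A ** matpow A k"

definition matexp :: "real^'n^'n \<Rightarrow> real^'n^'n" where
  "matexp A = (\<Sum>k. (1 / fact k) *\<^sub>R matpow A k)"

definition prop_L :: "(real^3 \<Rightarrow> real^3) \<Rightarrow> real \<Rightarrow> real \<Rightarrow> state \<Rightarrow> state" where
  "prop_L B \<epsilon> t = (\<lambda>(x, v). (x, matexp ((t / \<epsilon>) *\<^sub>R hat (B x)) *v v))"

(* The nonlinear propagator is implicit, so it is the relation between the old state
   (x, v) and a new state (x', v'). That the integral exists is part of the relation;
   it is automatic when E is continuous. *)
definition prop_NL :: "(real^3 \<Rightarrow> real^3) \<Rightarrow> real \<Rightarrow> state \<Rightarrow> state \<Rightarrow> bool" where
  "prop_NL E t = (\<lambda>(x, v) (x', v').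
     (\<lambda>\<rho>. E (\<rho> *\<^sub>R x + (1 - \<rho>) *\<^sub>R x')) integrable_on {0..1} \<and>
     x' = x + t *\<^sub>R v + (t\<^sup>2 / 2) *\<^sub>R integral {0..1} (\<lambda>\<rho>. E (\<rho> *\<^sub>R x + (1 - \<rho>) *\<^sub>R x')) \<and>
     v' = v + t *\<^sub>R integral {0..1} (\<lambda>\<rho>. E (\<rho> *\<^sub>R x + (1 - \<rho>) *\<^sub>R x')))"

datatype substep = Lin real | Nonlin real

fun substep_rel ::
  "(real^3 \<Rightarrow> real^3) \<Rightarrow> (real^3 \<Rightarrow> real^3) \<Rightarrow> real \<Rightarrow> real \<Rightarrow> substep \<Rightarrow> state \<Rightarrow> state \<Rightarrow> bool"
where
  "substep_rel B E \<epsilon> h (Lin a) s s' \<longleftrightarrow> s' = prop_L B \<epsilon> (a * h) s"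
| "substep_rel B E \<epsilon> h (Nonlin b) s s' \<longleftrightarrow> prop_NL E (b * h) s s'"

(* The head of the list is the substep performed first, i.e. the innermost factor of
   the composition. *)
fun splitting_step ::
  "(real^3 \<Rightarrow> real^3) \<Rightarrow> (real^3 \<Rightarrow> real^3) \<Rightarrow> real \<Rightarrow> real \<Rightarrow> substep list \<Rightarrow> state \<Rightarrow> state \<Rightarrow> bool"
where
  "splitting_step B E \<epsilon> h [] = (=)"
| "splitting_step B E \<epsilon> h (c # cs) = substep_rel B E \<epsilon> h c OO splitting_step B E \<epsilon> h cs"

definition S1_AVF :: "substep list" where
  "S1_AVF = [Lin 1, Nonlin 1]"

lemma splitting_step_S1_AVF:
  "splitting_step B E \<epsilon> h S1_AVF (x, v) (x', v') \<longleftrightarrow>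
     (let w = matexp ((h / \<epsilon>) *\<^sub>R hat (B x)) *v v;
          F = (\<lambda>\<rho>. E (\<rho> *\<^sub>R x + (1 - \<rho>) *\<^sub>R x'))
      in F integrable_on {0..1} \<and>
         x' = x + h *\<^sub>R w + (h\<^sup>2 / 2) *\<^sub>R integral {0..1} F \<and>
         v' = w + h *\<^sub>R integral {0..1} F)"
  by (simp add: S1_AVF_def prop_L_def prop_NL_def OO_def Let_def eq_commute[of _ v'])

end

(* Each propagator conserves the energy on its own. The exponential of a skew-symmetric matrix A is
   an isometry, because y(s) = exp(s A) v solves y' = A y and y . A y = 0. For the nonlinear
   propagator, let I be the averaged force; then
   (|v'|^2 - |v|^2) / 2 = (v' - v) . (v' + v) / 2 = I . (x' - x), which is U x - U x' by the
   fundamental theorem of calculus along the segment joining x and x'. *)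
theory Submission
  imports Defs
begin

lemma matpow_scaleR: "matpow (s *\<^sub>R A) k = s ^ k *\<^sub>R matpow A k"
  for A :: "real^'n^'n"
  by (induction k) (simp_all add: matrix_scalar_ac scalar_matrix_assoc mult.commute)

text \<open>Each entry of \<open>A\<close> is at most \<open>norm A\<close>, and each further factor
  \<open>A\<close> sums \<open>CARD('n)\<close> products. Geometric growth is all that the
  factorials in the exponential series have to beat.\<close>

lemma matpow_entry_bound:
  fixes A :: "real^'n^'n"
  shows "\<bar>matpow A k $ i $ j\<bar> \<le> (real CARD('n) * norm A) ^ k"
proof (induction k arbitrary: i)
  case 0
  then show ?case by (simp add: mat_def)
next
  case (Suc k)
  let ?c = "real CARD('n) * norm A"
  have "\<bar>matpow A (Suc k) $ i $ j\<bar> \<le> (\<Sum>l\<in>UNIV. \<bar>A $ i $ l * matpow A k $ l $ j\<bar>)"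
    by (simp add: matrix_matrix_mult_def)
  also have "\<dots> \<le> (\<Sum>l\<in>(UNIV::'n set). norm A * ?c ^ k)"
  proof (rule sum_mono)
    fix l
    have "\<bar>A $ i $ l\<bar> \<le> norm A"
      by (metis component_le_norm_cart order_trans Finite_Cartesian_Product.norm_nth_le)
    then show "\<bar>A $ i $ l * matpow A k $ l $ j\<bar> \<le> norm A * ?c ^ k"
      unfolding abs_mult by (intro mult_mono Suc.IH) auto
  qed
  also have "\<dots> = ?c ^ Suc k" by simp
  finally show ?case .
qed

text \<open>Dominated by the scalar exponential series at \<open>?c\<close>. The terms are arranged
  as a power series in \<open>s\<close>, ready for termwise differentiation.\<close>

lemma summable_matexp_entry:
  fixes A :: "real^'n^'n"
  shows "summable (\<lambda>k. (matpow A k $ i $ j / fact k) * s ^ k)"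
proof (rule summable_comparison_test')
  let ?c = "real CARD('n) * norm A * \<bar>s\<bar>"
  show "summable (\<lambda>k. inverse (fact k) * ?c ^ k)"
    by (rule summable_exp)
  fix k
  have "\<bar>matpow A k $ i $ j\<bar> * (inverse (fact k) * \<bar>s\<bar> ^ k)
      \<le> (real CARD('n) * norm A) ^ k * (inverse (fact k) * \<bar>s\<bar> ^ k)"
    by (intro mult_right_mono matpow_entry_bound) simp
  then show "norm ((matpow A k $ i $ j / fact k) * s ^ k) \<le> inverse (fact k) * ?c ^ k"
    by (simp add: abs_mult power_abs power_mult_distrib divide_inverse mult_ac)
qed

lemma matexp_scaleR_entry:
  fixes A :: "real^'n^'n"
  shows "matexp (s *\<^sub>R A) $ i $ j = (\<Sum>k. (matpow A k $ i $ j / fact k) * s ^ k)"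
proof -
  let ?f = "\<lambda>k. (1 / fact k) *\<^sub>R matpow (s *\<^sub>R A) k"
  let ?S = "\<chi> i j. \<Sum>k. (matpow A k $ i $ j / fact k) * s ^ k"
  \<comment> \<open>Convergence of matrices is convergence of all entries, so the series in
    \<open>matexp\<close> has the matrix of entrywise sums as its value.\<close>
  have "?f sums ?S"
    unfolding sums_def
  proof (intro vec_tendstoI)
    fix i j
    have "(\<lambda>k. ?f k $ i $ j) sums (?S $ i $ j)"
      using summable_sums[OF summable_matexp_entry[of A i j s]]
      by (simp add: matpow_scaleR mult_ac)
    then show "(\<lambda>n. (\<Sum>k<n. ?f k) $ i $ j) \<longlonglongrightarrow> ?S $ i $ j"
      by (simp add: sums_def)
  qed
  then show ?thesis
    by (simp add: matexp_def sums_iff)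
qed

text \<open>This is Y' = A Y for Y(s) = exp(s A), read off one entry at a time by differentiating
  its power series termwise.\<close>

lemma DERIV_matexp_entry:
  fixes A :: "real^'n^'n"
  shows "((\<lambda>s. matexp (s *\<^sub>R A) $ i $ j) has_real_derivative (A ** matexp (s *\<^sub>R A)) $ i $ j) (at s)"
proof -
  let ?c = "\<lambda>i k. matpow A k $ i $ j / fact k"
  \<comment> \<open>The factor k + 1 from differentiation cancels against
    \<open>fact (Suc k)\<close>, and \<open>matpow A (Suc k)\<close> splits off row \<open>i\<close>
    of \<open>A\<close>.\<close>
  have diffs: "diffs (?c i) k * s ^ k = (\<Sum>l\<in>UNIV. A $ i $ l * (?c l k * s ^ k))" for k
  proof -
    have "diffs (?c i) k = matpow A (Suc k) $ i $ j / fact k"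
      by (simp add: diffs_def field_simps del: matpow.simps of_nat_Suc)
    then show ?thesis
      by (simp add: matrix_matrix_mult_def sum_divide_distrib sum_distrib_right sum_distrib_left mult_ac)
  qed
  have "(\<Sum>k. diffs (?c i) k * s ^ k) = (\<Sum>l\<in>UNIV. \<Sum>k. A $ i $ l * (?c l k * s ^ k))"
    unfolding diffs by (intro suminf_sum summable_mult summable_matexp_entry)
  also have "\<dots> = (A ** matexp (s *\<^sub>R A)) $ i $ j"
    by (simp only: matrix_matrix_mult_def matexp_scaleR_entry vec_lambda_beta
        suminf_mult[OF summable_matexp_entry])
  finally show ?thesis
    using termdiffs_strong_converges_everywhere[of "?c i" s] summable_matexp_entry[of A i j]
    by (simp add: matexp_scaleR_entry)
qed

lemma DERIV_matexp_mult_vec: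
  fixes A :: "real^'n^'n"
  shows "((\<lambda>s. (matexp (s *\<^sub>R A) *v v) $ i) has_real_derivative
           (A *v (matexp (s *\<^sub>R A) *v v)) $ i) (at s)"
proof -
  have "((\<lambda>s. \<Sum>j\<in>UNIV. matexp (s *\<^sub>R A) $ i $ j * v $ j) has_real_derivative
          (\<Sum>j\<in>UNIV. (A ** matexp (s *\<^sub>R A)) $ i $ j * v $ j)) (at s)"
    by (intro DERIV_sum DERIV_cmult_right DERIV_matexp_entry)
  then show ?thesis
    unfolding matrix_vector_mul_assoc by (simp add: matrix_vector_mult_def)
qed

lemma matexp_zero: "matexp (0 :: real^'n^'n) = mat 1"
proof -
  \<comment> \<open>Writing 0 as a multiple of itself makes the power series formula applicable; at
    \<open>s = 0\<close> only its constant term \<open>mat 1\<close> survives.\<close>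
  have "matexp ((0::real) *\<^sub>R (0 :: real^'n^'n)) $ i $ j = mat 1 $ i $ j" for i j
    unfolding matexp_scaleR_entry by (simp only: powser_zero) simp
  then show ?thesis
    by (simp add: vec_eq_iff)
qed

text \<open>Moving \<open>A\<close> to the other factor replaces it by its transpose
  \<open>- A\<close>, so the number equals its own negative.\<close>

lemma inner_skew_mult_vec:
  fixes A :: "real^'n^'n"
  assumes "transpose A = - A"
  shows "y \<bullet> (A *v y) = 0"
proof -
  have "y \<bullet> (A *v y) = (transpose A *v y) \<bullet> y"
    by (simp add: dot_lmul_matrix flip: vector_transpose_matrix)
  also have "\<dots> = - (y \<bullet> (A *v y))"
    using assms
    by (simp add: inner_commute matrix_vector_mult_def inner_vec_def sum_negf)
  finally show ?thesis by simp
qed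

lemma norm_matexp_skew:
  fixes A :: "real^'n^'n"
  assumes "transpose A = - A"
  shows "norm (matexp A *v v) = norm v"
proof -
  define y where "y s = matexp (s *\<^sub>R A) *v v" for s
  have "((\<lambda>s. y s \<bullet> y s) has_real_derivative 0) (at s)" for s
  proof -
    \<comment> \<open>The inner product is expanded into coordinates because y' = A y is available
      coordinate by coordinate.\<close>
    have "((\<lambda>s. \<Sum>i\<in>UNIV. y s $ i * y s $ i) has_real_derivative
        (\<Sum>i\<in>UNIV. (A *v y s) $ i * y s $ i + (A *v y s) $ i * y s $ i)) (at s)"
      unfolding y_def by (intro DERIV_sum DERIV_mult DERIV_matexp_mult_vec)
    moreover have "(\<Sum>i\<in>UNIV. (A *v y s) $ i * y s $ i + (A *v y s) $ i * y s $ i)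
        = 2 * (y s \<bullet> (A *v y s))"
      by (simp add: inner_vec_def sum_distrib_left mult_ac)
    ultimately show ?thesis
      using inner_skew_mult_vec[OF assms] by (simp add: inner_vec_def)
  qed
  then have "y 1 \<bullet> y 1 = y 0 \<bullet> y 0"
    by (metis DERIV_isconst_all)
  then show ?thesis
    by (simp add: y_def matexp_zero norm_eq_sqrt_inner)
qed

lemma transpose_scaleR_hat: "transpose (s *\<^sub>R hat b) = - (s *\<^sub>R hat b)"
  by (simp add: hat_def transpose_def vec_eq_iff forall_3)

lemma energy_prop_L: "energy U (prop_L B \<epsilon> t s) = energy U s"
  by (cases s) (simp add: energy_def prop_L_def norm_matexp_skew transpose_scaleR_hat)

text \<open>The segment runs from \<open>x'\<close> at \<rho> = 0 to \<open>x\<close> at \<rho> = 1,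
  which fixes the sign. The fundamental theorem for the gauge integral also yields integrability of
  the derivative, so differentiability of \<open>U\<close> suffices.\<close>

lemma integral_gradient_segment:
  fixes U :: "'a::real_inner \<Rightarrow> real"
  assumes "\<And>y. GDERIV U y :> G y"
  shows "((\<lambda>\<rho>. G (\<rho> *\<^sub>R x + (1 - \<rho>) *\<^sub>R x') \<bullet> (x - x')) has_integral U x - U x') {0..1}"
proof -
  let ?p = "\<lambda>\<rho>. \<rho> *\<^sub>R x + (1 - \<rho>) *\<^sub>R x'"
  have "((\<lambda>\<rho>. U (?p \<rho>)) has_vector_derivative G (?p \<rho>) \<bullet> (x - x')) (at \<rho> within {0..1})" for \<rho>
  proof -
    have "(?p has_derivative (\<lambda>t. t *\<^sub>R (x - x'))) (at \<rho> within {0..1})"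
      by (auto intro!: derivative_eq_intros simp: algebra_simps)
    moreover have "(U has_derivative (\<lambda>k. k \<bullet> G (?p \<rho>))) (at (?p \<rho>))"
      using assms by (simp add: gderiv_def)
    ultimately have "((\<lambda>\<rho>. U (?p \<rho>)) has_derivative (\<lambda>t. (t *\<^sub>R (x - x')) \<bullet> G (?p \<rho>)))
        (at \<rho> within {0..1})"
      by (rule has_derivative_compose)
    then show ?thesis
      by (simp add: has_vector_derivative_def inner_commute)
  qed
  then show ?thesis
    using fundamental_theorem_of_calculus[of 0 1 "\<lambda>\<rho>. U (?p \<rho>)"] by simp
qed

lemma energy_prop_NL:
  assumes grad: "\<And>y. GDERIV U y :> - E y"
    and step: "prop_NL E t s s'"
  shows "energy U s' = energy U s"
proof -
  obtain x v x' v' where s: "s = (x, v)" "s' = (x', v')"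
    by fastforce
  define F where "F \<rho> = E (\<rho> *\<^sub>R x + (1 - \<rho>) *\<^sub>R x')" for \<rho>
  define I where "I = integral {0..1} F"
  have F: "F integrable_on {0..1}"
    and x': "x' = x + t *\<^sub>R v + (t\<^sup>2 / 2) *\<^sub>R I" and v': "v' = v + t *\<^sub>R I"
    using step by (simp_all add: s prop_NL_def F_def[abs_def] I_def)
  have "((\<lambda>\<rho>. F \<rho> \<bullet> (x' - x)) has_integral I \<bullet> (x' - x)) {0..1}"
    using has_integral_linear[OF integrable_integral[OF F] bounded_linear_inner_left]
    by (simp add: o_def I_def)
  \<comment> \<open>With gradient \<open>- E\<close>, the minus sign is absorbed by reversing
    \<open>x - x'\<close>.\<close>
  moreover have "((\<lambda>\<rho>. F \<rho> \<bullet> (x' - x)) has_integral U x - U x') {0..1}"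
    using integral_gradient_segment[OF grad, of x x'] by (simp add: F_def inner_diff_right)
  ultimately have "U x - U x' = I \<bullet> (x' - x)"
    by (rule has_integral_unique[symmetric])
  \<comment> \<open>By the update formulas, both sides equal t (v . I) + (t^2 / 2) (I . I).\<close>
  also have "\<dots> = ((norm v')\<^sup>2 - (norm v)\<^sup>2) / 2"
    unfolding x' v' power2_norm_eq_inner
    by (simp add: inner_simps inner_commute power2_eq_square field_simps)
  finally show ?thesis
    by (simp add: s energy_def field_simps)
qed

text \<open>Both propagators conserve the energy for every real time, so the coefficients may be
  arbitrary. The start state is generalized in the induction, since the remaining substeps begin at
  the intermediate state \<open>u\<close>.\<close>

lemma energy_splitting_step:
  assumes grad: "\<And>y. GDERIV U y :> - E y"
    and "splitting_step B E \<epsilon> h cs s s'"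
  shows "energy U s' = energy U s"
  using assms(2)
proof (induction cs arbitrary: s)
  case Nil
  then show ?case by simp
next
  case (Cons c cs)
  then obtain u where u: "substep_rel B E \<epsilon> h c s u" "splitting_step B E \<epsilon> h cs u s'"
    by auto
  have "energy U u = energy U s"
    using u(1) by (cases c) (simp_all add: energy_prop_L energy_prop_NL[OF grad])
  then show ?case
    using Cons.IH[OF u(2)] by simp
qed

theorem proposition2p3:
  fixes U :: "real^3 \<Rightarrow> real" and E B :: "real^3 \<Rightarrow> real^3"
    and \<epsilon> h :: real and cs :: "substep list"
    and x v :: "nat \<Rightarrow> real^3" and x0 v0 :: "real^3"
  assumes "\<And>y. GDERIV U y :> - E y"
    and "0 < \<epsilon>" "\<epsilon> \<le> 1" "0 < h"
    and "x 0 = x0" "v 0 = v0"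
    and "\<And>n. splitting_step B E \<epsilon> h cs (x n, v n) (x (Suc n), v (Suc n))"
  shows "\<forall>n. energy U (x n, v n) = energy U (x 0, v 0)"
proof
  fix n
  show "energy U (x n, v n) = energy U (x 0, v 0)"
    by (induction n) (simp_all add: energy_splitting_step[OF assms(1) assms(7)])
qed

end
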